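(* Let $G$ be a graph with $n$ vertices and let $H$ be an anchor of $G$ with at most $n-3$ vertices. If the shadow graph $\underline{G}_{/H}$ is reconstructible, then $G$ is reconstructible.
   Context: All graphs are finite and simple; subgraphs are vertex-induced. The deck of a graph $G$ is the multiset of isomorphism classes of the graphs $G\setminus v$, $v\in V(G)$; $G$ is reconstructible if every graph with the same deck as $G$ is isomorphic to $G$. An anchor of $G$ is a proper nonempty induced subgraph $H$ that occurs exactly once in $G$: no vertex set $W\neq V(H)$ satisfies $G[W]\cong H$. A shadow graph $\underline{G}$ on a background graph $H$ is a finite simple graph each of whose vertices $\underline{v}$ is (labelled by) a subset of $V(H)$; different vertices may carry the same subset, and the edges of $\underline{G}$ do not depend on $H$. Shadow graphs $\underline{G}$ on $H$ and $\underline{G}'$ on $H'$ are isomorphic if there are a graph isomorphism $f:H\to H'$ and a bijection of the vertices of $\underline{G}$ onto the vertices of $\underline{G}'$ that preserves adjacency and non-adjacency and sends each vertex with subset $S$ to a vertex with subset $f(S)$. The deck of $\underline{G}$ is the multiset of isomorphism classes of the shadow graphs $\underline{G}\setminus\underline{v}$ (delete the vertex $\underline{v}$, keep the background graph $H$ whole) over all vertices $\underline{v}$; $\underline{G}$ is reconstructible if every shadow graph with the same deck is isomorphic to $\underline{G}$. For an induced subgraph $H$ of a graph $G$, the shadow graph $\underline{G}_{/H}$ has background graph $H$, one vertex $\underline{s_v}$ for each $v\in V(G)\setminus V(H)$, carrying the subset $N(v)\cap V(H)$, and $\underline{s_v},\underline{s_w}$ are adjacent if and only if $v,w$ are adjacent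 in $G$. *)

theory Defs
  imports "Graph_Theory.Graph_Theory" "HOL-Library.Multiset"
begin

text \<open>
  Finite simple graphs are the symmetric loop-free digraphs \<open>pair_graph\<close> of Graph_Theory:
  an undirected edge is a pair of opposite arcs in \<open>parcs\<close>.
\<close>

section \<open>Graphs\<close>

text \<open>Only used for \<open>W \<subseteq> pverts G\<close>.\<close>
definition induced :: "'a pair_pre_digraph \<Rightarrow> 'a set \<Rightarrow> 'a pair_pre_digraph" where
  "induced G W = \<lparr>pverts = W, parcs = {e \<in> parcs G. fst e \<in> W \<and> snd e \<in> W}\<rparr>"

definition delete_vertex :: "'a pair_pre_digraph \<Rightarrow> 'a \<Rightarrow> 'a pair_pre_digraph" where
  "delete_vertex G v = induced G (pverts G - {v})"

definition graph_isomorphism ::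
    "('a \<Rightarrow> 'b) \<Rightarrow> 'a pair_pre_digraph \<Rightarrow> 'b pair_pre_digraph \<Rightarrow> bool" where
  "graph_isomorphism f G H \<longleftrightarrow>
     bij_betw f (pverts G) (pverts H) \<and>
     (\<forall>u \<in> pverts G. \<forall>v \<in> pverts G. (u, v) \<in> parcs G \<longleftrightarrow> (f u, f v) \<in> parcs H)"

definition isomorphic :: "'a pair_pre_digraph \<Rightarrow> 'b pair_pre_digraph \<Rightarrow> bool" where
  "isomorphic G H \<longleftrightarrow> (\<exists>f. graph_isomorphism f G H)"

text \<open>
  HOL has no type of all finite graphs. Since every finite graph has an isomorphic copy with
  vertices in \<open>nat\<close>, an isomorphism class is represented by the set of its members on \<open>nat\<close>, and
  reconstructibility quantifies over the graphs on \<open>nat\<close>. The lemmas \<open>iso_class_eq_iff\<close> and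
  \<open>reconstructibleD\<close> (and their analogues for shadow graphs) show that nothing is lost.
\<close>
definition iso_class :: "'a pair_pre_digraph \<Rightarrow> nat pair_pre_digraph set" where
  "iso_class G = {K. pair_graph K \<and> isomorphic K G}"

definition deck :: "'a pair_pre_digraph \<Rightarrow> nat pair_pre_digraph set multiset" where
  "deck G = image_mset (\<lambda>v. iso_class (delete_vertex G v)) (mset_set (pverts G))"

definition reconstructible :: "'a pair_pre_digraph \<Rightarrow> bool" where
  "reconstructible G \<longleftrightarrow>
     (\<forall>G' :: nat pair_pre_digraph. pair_graph G' \<and> deck G' = deck G \<longrightarrow> isomorphic G' G)"

definition anchor :: "'a pair_pre_digraph \<Rightarrow> 'a pair_pre_digraph \<Rightarrow> bool" where
  "anchor H G \<longleftrightarrow>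
     induced_subgraph (with_proj H) (with_proj G) \<and>
     pverts H \<noteq> {} \<and> pverts H \<noteq> pverts G \<and>
     \<not> (\<exists>W \<subseteq> pverts G. W \<noteq> pverts H \<and> isomorphic (induced G W) H)"


section \<open>Shadow graphs\<close>

text \<open>
  The vertices of a shadow graph carry subsets of the background via \<open>label\<close>, which need not be
  injective; its values outside the vertices of \<open>overlay\<close> are irrelevant.
\<close>
record ('a, 'v) shadow_graph =
  background :: "'a pair_pre_digraph"
  overlay :: "'v pair_pre_digraph"
  label :: "'v \<Rightarrow> 'a set"

definition is_shadow_graph :: "('a, 'v) shadow_graph \<Rightarrow> bool" where
  "is_shadow_graph S \<longleftrightarrow>
     pair_graph (background S) \<and> pair_graph (overlay S) \<and>
     (\<forall>v \<in> pverts (overlay S). label S v \<subseteq> pverts (background S))"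

definition shadow_isomorphic :: "('a, 'v) shadow_graph \<Rightarrow> ('b, 'w) shadow_graph \<Rightarrow> bool" where
  "shadow_isomorphic S T \<longleftrightarrow>
     (\<exists>f g. graph_isomorphism f (background S) (background T) \<and>
            graph_isomorphism g (overlay S) (overlay T) \<and>
            (\<forall>v \<in> pverts (overlay S). label T (g v) = f ` label S v))"

definition shadow_delete_vertex :: "('a, 'v) shadow_graph \<Rightarrow> 'v \<Rightarrow> ('a, 'v) shadow_graph" where
  "shadow_delete_vertex S v = S\<lparr>overlay := delete_vertex (overlay S) v\<rparr>"

definition shadow_iso_class :: "('a, 'v) shadow_graph \<Rightarrow> (nat, nat) shadow_graph set" where
  "shadow_iso_class S = {K. is_shadow_graph K \<and> shadow_isomorphic K S}"

definition shadow_deck :: "('a, 'v) shadow_graph \<Rightarrow> (nat, nat) shadow_graph set multiset" where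
  "shadow_deck S =
     image_mset (\<lambda>v. shadow_iso_class (shadow_delete_vertex S v)) (mset_set (pverts (overlay S)))"

definition shadow_reconstructible :: "('a, 'v) shadow_graph \<Rightarrow> bool" where
  "shadow_reconstructible S \<longleftrightarrow>
     (\<forall>S' :: (nat, nat) shadow_graph.
        is_shadow_graph S' \<and> shadow_deck S' = shadow_deck S \<longrightarrow> shadow_isomorphic S' S)"

text \<open>The shadow vertex of \<open>v\<close> is \<open>v\<close> itself.\<close>
definition shadow_of :: "'a pair_pre_digraph \<Rightarrow> 'a pair_pre_digraph \<Rightarrow> ('a, 'a) shadow_graph" where
  "shadow_of G H =
     \<lparr>background = H,
      overlay = induced G (pverts G - pverts H),
      label = (\<lambda>v. {w \<in> pverts H. (v, w) \<in> parcs G})\<rparr>"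


section \<open>Adequacy of the encoding\<close>

lemma with_proj_induced: "with_proj (induced G W) = with_proj G \<restriction> W"
  by (simp add: induced_def with_proj_def induce_subgraph_def)

lemma with_proj_delete_vertex:
  assumes "pair_graph G"
  shows "with_proj (delete_vertex G v) = pre_digraph.del_vert (with_proj G) v"
proof -
  interpret pair_graph G by fact
  show ?thesis
    by (auto simp: delete_vertex_def induced_def with_proj_def pre_digraph.del_vert_def
        dest: arc_fst_in_verts arc_snd_in_verts)
qed

lemma induced_subgraph_eq_induced:
  assumes "induced_subgraph (with_proj H) (with_proj G)"
  shows "H = induced G (pverts H)"
  using assms by (simp add: induced_subgraph_def induced_def)

lemma pair_graphI:
  assumes "finite (pverts G)" "parcs G \<subseteq> pverts G \<times> pverts G" "sym (parcs G)" "irrefl (parcs G)"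
  shows "pair_graph G"
proof
  show "finite (parcs G)"
    using assms(1,2) finite_subset by blast
qed (use assms in \<open>auto simp: symmetric_def irrefl_def\<close>)

lemma pair_graphD:
  assumes "pair_graph G"
  shows "finite (pverts G)" "parcs G \<subseteq> pverts G \<times> pverts G" "sym (parcs G)" "irrefl (parcs G)"
proof -
  interpret pair_graph G by fact
  show "finite (pverts G)" by simp
  show "parcs G \<subseteq> pverts G \<times> pverts G" by (auto dest: in_arcsD1 in_arcsD2)
  show "sym (parcs G)" by (auto intro: symI arcs_symmetric)
  show "irrefl (parcs G)" by (auto simp: irrefl_def dest: no_loops')
qed

lemma pair_graph_induced:
  assumes "pair_graph G" "W \<subseteq> pverts G"
  shows "pair_graph (induced G W)"
proof (rule pair_graphI)
  note G = pair_graphD[OF assms(1)]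
  show "finite (pverts (induced G W))"
    using G(1) assms(2) by (simp add: induced_def finite_subset)
  show "sym (parcs (induced G W))"
    using G(3) by (auto simp: induced_def sym_def)
  show "irrefl (parcs (induced G W))"
    using G(4) by (auto simp: induced_def irrefl_def)
qed (auto simp: induced_def)

lemma is_shadow_graph_shadow_of:
  assumes "pair_graph G" "induced_subgraph (with_proj H) (with_proj G)"
  shows "is_shadow_graph (shadow_of G H)"
proof -
  have "pverts H \<subseteq> pverts G"
    using assms(2) by (auto simp: induced_subgraph_def subgraph_def)
  then have "pair_graph H"
    using assms induced_subgraph_eq_induced pair_graph_induced by metis
  moreover have "pair_graph (induced G (pverts G - pverts H))"
    using assms(1) by (intro pair_graph_induced) auto
  ultimately show ?thesis
    by (auto simp: is_shadow_graph_def shadow_of_def)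
qed

lemma is_shadow_graph_delete_vertex:
  "is_shadow_graph S \<Longrightarrow> is_shadow_graph (shadow_delete_vertex S v)"
  using pair_graph_induced[of "overlay S" "pverts (overlay S) - {v}"]
  by (auto simp: is_shadow_graph_def shadow_delete_vertex_def delete_vertex_def induced_def)

lemma graph_isomorphism_id: "graph_isomorphism id G G"
  by (simp add: graph_isomorphism_def)

lemma graph_isomorphism_comp:
  assumes "graph_isomorphism f G H" "graph_isomorphism g H K"
  shows "graph_isomorphism (g \<circ> f) G K"
proof -
  have "bij_betw (g \<circ> f) (pverts G) (pverts K)"
    using assms by (auto simp: graph_isomorphism_def elim: bij_betw_trans)
  moreover have "f u \<in> pverts H" if "u \<in> pverts G" for u
    using assms(1) that by (auto simp: graph_isomorphism_def bij_betw_def)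
  ultimately show ?thesis
    using assms by (simp add: graph_isomorphism_def)
qed

lemma graph_isomorphism_inv:
  assumes "graph_isomorphism f G H"
  shows "graph_isomorphism (inv_into (pverts G) f) H G"
proof -
  have bij: "bij_betw f (pverts G) (pverts H)"
    using assms by (simp add: graph_isomorphism_def)
  then have "inv_into (pverts G) f w \<in> pverts G" "f (inv_into (pverts G) f w) = w"
    if "w \<in> pverts H" for w
    using that by (auto simp: bij_betw_def intro: inv_into_into f_inv_into_f)
  then show ?thesis
    using assms bij_betw_inv_into[OF bij] by (simp add: graph_isomorphism_def)
qed

lemma isomorphic_refl: "isomorphic G G"
  using graph_isomorphism_id isomorphic_def by blast

lemma isomorphic_sym: "isomorphic G H \<Longrightarrow> isomorphic H G"
  using graph_isomorphism_inv isomorphic_def by metis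

lemma isomorphic_trans: "isomorphic G H \<Longrightarrow> isomorphic H K \<Longrightarrow> isomorphic G K"
  using graph_isomorphism_comp isomorphic_def by metis

lemma ex_graph_isomorphism_nat:
  fixes G :: "'a pair_pre_digraph"
  assumes "pair_graph G"
  obtains K :: "nat pair_pre_digraph" and f where "pair_graph K" "graph_isomorphism f K G"
proof -
  note G = pair_graphD[OF assms]
  obtain f :: "nat \<Rightarrow> 'a" where f: "bij_betw f {0..<card (pverts G)} (pverts G)"
    using ex_bij_betw_nat_finite G(1) by blast
  let ?n = "{0..<card (pverts G)}"
  define K where "K = \<lparr>pverts = ?n, parcs = {(i, j). i \<in> ?n \<and> j \<in> ?n \<and> (f i, f j) \<in> parcs G}\<rparr>"
  have "pair_graph K"
    using G(3,4) by (intro pair_graphI) (auto simp: K_def sym_def irrefl_def)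
  moreover have "graph_isomorphism f K G"
    using f by (auto simp: K_def graph_isomorphism_def)
  ultimately show ?thesis by (rule that)
qed

lemma isomorphic_iff_digraph_iso:
  assumes "pair_graph G" "pair_graph H"
  shows "isomorphic G H \<longleftrightarrow> digraph_iso (with_proj G) (with_proj H)"
proof
  note G = pair_graphD[OF assms(1)] and H = pair_graphD[OF assms(2)]
  assume "isomorphic G H"
  then obtain f where f: "bij_betw f (pverts G) (pverts H)"
      "\<And>u v. u \<in> pverts G \<Longrightarrow> v \<in> pverts G \<Longrightarrow> (u, v) \<in> parcs G \<longleftrightarrow> (f u, f v) \<in> parcs H"
    by (auto simp: isomorphic_def graph_isomorphism_def)
  let ?h = "\<lparr>iso_verts = f, iso_arcs = map_prod f f, iso_head = snd, iso_tail = fst\<rparr>"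
  have inj: "inj_on f (pverts G)" and im: "f ` pverts G = pverts H"
    using f(1) by (auto simp: bij_betw_def)
  have "inj_on (map_prod f f) (parcs G)"
    using map_prod_inj_on[OF inj inj] G(2) by (rule inj_on_subset)
  moreover have "wf_digraph (with_proj G)"
    using assms(1) by (simp add: wf_digraph_wp_iff pair_graph_def pair_digraph_def pair_fin_digraph_def)
  ultimately have "pre_digraph.digraph_isomorphism (with_proj G) ?h"
    using inj by (simp add: pre_digraph.digraph_isomorphism_def)
  moreover have "map_prod f f ` parcs G = parcs H"
  proof
    show "map_prod f f ` parcs G \<subseteq> parcs H"
      using f(2) G(2) by auto
    show "parcs H \<subseteq> map_prod f f ` parcs G"
    proof
      fix e assume e: "e \<in> parcs H"
      then have "fst e \<in> f ` pverts G" "snd e \<in> f ` pverts G"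
        using H(2) im by auto
      then obtain u v where uv: "u \<in> pverts G" "v \<in> pverts G" "e = (f u, f v)"
        by (metis imageE prod.collapse)
      then have "(u, v) \<in> parcs G"
        using e f(2) by simp
      then show "e \<in> map_prod f f ` parcs G"
        using uv(3) by force
    qed
  qed
  ultimately have "pre_digraph.digraph_isomorphism (with_proj G) ?h \<and>
      with_proj H = app_iso ?h (with_proj G)"
    using im by (simp add: app_iso_def with_proj_def)
  then show "digraph_iso (with_proj G) (with_proj H)"
    unfolding digraph_iso_def by blast
next
  note G = pair_graphD[OF assms(1)]
  assume "digraph_iso (with_proj G) (with_proj H)"
  then obtain h where h: "pre_digraph.digraph_isomorphism (with_proj G) h"
      "with_proj H = app_iso h (with_proj G)"
    by (auto simp: digraph_iso_def)
  let ?f = "iso_verts h"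
  have H: "pverts H = ?f ` pverts G" "parcs H = iso_arcs h ` parcs G"
      "iso_tail h = fst" "iso_head h = snd"
    using h(2) by (simp_all add: app_iso_def with_proj_def)
  have inj: "inj_on ?f (pverts G)"
    using h(1) by (simp add: pre_digraph.digraph_isomorphism_def)
  have "iso_arcs h e = map_prod ?f ?f e" if "e \<in> parcs G" for e
    using h(1) that H(3,4)
    by (auto simp: pre_digraph.digraph_isomorphism_def map_prod_def prod_eq_iff split: prod.split)
  then have "parcs H = map_prod ?f ?f ` parcs G"
    using H(2) by simp
  moreover have "(?f u, ?f v) \<in> map_prod ?f ?f ` parcs G \<longleftrightarrow> (u, v) \<in> parcs G"
    if "u \<in> pverts G" "v \<in> pverts G" for u v
  proof
    assume "(?f u, ?f v) \<in> map_prod ?f ?f ` parcs G"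
    then obtain u' v' where uv': "(u', v') \<in> parcs G" "?f u = ?f u'" "?f v = ?f v'"
      by auto
    then have "u = u'" "v = v'"
      using G(2) inj that by (auto dest: inj_onD)
    then show "(u, v) \<in> parcs G"
      using uv'(1) by simp
  qed force
  ultimately have "graph_isomorphism ?f G H"
    using inj H(1) by (simp add: graph_isomorphism_def bij_betw_def)
  then show "isomorphic G H"
    by (auto simp: isomorphic_def)
qed

lemma iso_class_eq_iff:
  assumes "pair_graph G" "pair_graph H"
  shows "iso_class G = iso_class H \<longleftrightarrow> isomorphic G H"
proof
  assume eq: "iso_class G = iso_class H"
  obtain K :: "nat pair_pre_digraph" where "pair_graph K" "isomorphic K G"
    using ex_graph_isomorphism_nat[OF assms(1)] isomorphic_def by metis
  then have "isomorphic K H"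
    using eq by (auto simp: iso_class_def)
  with \<open>isomorphic K G\<close> show "isomorphic G H"
    using isomorphic_sym isomorphic_trans by metis
next
  assume "isomorphic G H"
  then have "isomorphic K G \<longleftrightarrow> isomorphic K H" for K :: "nat pair_pre_digraph"
    using isomorphic_sym isomorphic_trans by metis
  then show "iso_class G = iso_class H"
    by (simp add: iso_class_def)
qed

lemma graph_isomorphism_delete_vertex:
  assumes f: "graph_isomorphism f G H" and v: "v \<in> pverts G"
  shows "graph_isomorphism f (delete_vertex G v) (delete_vertex H (f v))"
proof -
  have inj: "inj_on f (pverts G)" and im: "f ` pverts G = pverts H"
    using f by (auto simp: graph_isomorphism_def bij_betw_def)
  have "f ` (pverts G - {v}) = pverts H - {f v}"
    using inj_on_image_set_diff[OF inj, of "pverts G" "{v}"] v im by simp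
  moreover have "f u \<in> pverts H - {f v}" if "u \<in> pverts G - {v}" for u
    using calculation that by blast
  ultimately show ?thesis
    using f inj by (auto simp: graph_isomorphism_def delete_vertex_def induced_def bij_betw_def
        intro: inj_on_subset)
qed

lemma deck_isomorphic:
  fixes G :: "'a pair_pre_digraph" and H :: "'b pair_pre_digraph"
  assumes "pair_graph G" "pair_graph H" "isomorphic G H"
  shows "deck G = deck H"
proof -
  obtain f where f: "graph_isomorphism f G H"
    using assms(3) isomorphic_def by blast
  then have bij: "bij_betw f (pverts G) (pverts H)"
    by (simp add: graph_isomorphism_def)
  have "iso_class (delete_vertex H (f v)) = iso_class (delete_vertex G v)"
    if v: "v \<in> pverts G" for v
  proof -
    have "isomorphic (delete_vertex G v) (delete_vertex H (f v))"
      using graph_isomorphism_delete_vertex[OF f v] isomorphic_def by blast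
    moreover have "pair_graph (delete_vertex G v)" "pair_graph (delete_vertex H (f v))"
      using assms(1,2) by (auto simp: delete_vertex_def intro: pair_graph_induced)
    ultimately show ?thesis
      using iso_class_eq_iff by blast
  qed
  then have "deck G = image_mset (\<lambda>v. iso_class (delete_vertex H (f v))) (mset_set (pverts G))"
    unfolding deck_def using pair_graphD(1)[OF assms(1)]
    by (intro image_mset_cong) auto
  also have "\<dots> = image_mset (\<lambda>w. iso_class (delete_vertex H w)) (image_mset f (mset_set (pverts G)))"
    by (simp add: image_mset.compositionality o_def)
  also have "image_mset f (mset_set (pverts G)) = mset_set (pverts H)"
    using bij by (auto simp: bij_betw_def image_mset_mset_set)
  finally show ?thesis
    by (simp add: deck_def)
qed

lemma reconstructibleD:
  fixes G :: "'a pair_pre_digraph" and G' :: "'b pair_pre_digraph"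
  assumes "reconstructible G" "pair_graph G'" "deck G' = deck G"
  shows "isomorphic G' G"
proof -
  obtain K :: "nat pair_pre_digraph" and f where K: "pair_graph K" "graph_isomorphism f K G'"
    using ex_graph_isomorphism_nat[OF assms(2)] .
  then have iso: "isomorphic K G'"
    by (auto simp: isomorphic_def)
  then have "deck K = deck G"
    using deck_isomorphic[OF K(1) assms(2)] assms(3) by simp
  then have "isomorphic K G"
    using assms(1) K(1) unfolding reconstructible_def by blast
  with iso show ?thesis
    using isomorphic_sym isomorphic_trans by metis
qed

lemma shadow_isomorphic_refl: "shadow_isomorphic S S"
  unfolding shadow_isomorphic_def by (intro exI[of _ id]) (simp add: graph_isomorphism_id)

lemma shadow_isomorphic_trans:
  assumes "shadow_isomorphic S T" "shadow_isomorphic T U"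
  shows "shadow_isomorphic S U"
proof -
  obtain f g where fg: "graph_isomorphism f (background S) (background T)"
      "graph_isomorphism g (overlay S) (overlay T)"
      "\<And>v. v \<in> pverts (overlay S) \<Longrightarrow> label T (g v) = f ` label S v"
    using assms(1) unfolding shadow_isomorphic_def by blast
  obtain f' g' where fg': "graph_isomorphism f' (background T) (background U)"
      "graph_isomorphism g' (overlay T) (overlay U)"
      "\<And>v. v \<in> pverts (overlay T) \<Longrightarrow> label U (g' v) = f' ` label T v"
    using assms(2) unfolding shadow_isomorphic_def by blast
  have "g v \<in> pverts (overlay T)" if "v \<in> pverts (overlay S)" for v
    using fg(2) that by (auto simp: graph_isomorphism_def dest: bij_betwE)
  then have "\<forall>v \<in> pverts (overlay S). label U ((g' \<circ> g) v) = (f' \<circ> f) ` label S v"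
    using fg(3) fg'(3) by (auto simp: image_comp)
  then show ?thesis
    unfolding shadow_isomorphic_def
    using graph_isomorphism_comp[OF fg(1) fg'(1)] graph_isomorphism_comp[OF fg(2) fg'(2)] by blast
qed

lemma shadow_isomorphic_sym:
  assumes "is_shadow_graph S" "shadow_isomorphic S T"
  shows "shadow_isomorphic T S"
proof -
  obtain f g where fg: "graph_isomorphism f (background S) (background T)"
      "graph_isomorphism g (overlay S) (overlay T)"
      "\<And>v. v \<in> pverts (overlay S) \<Longrightarrow> label T (g v) = f ` label S v"
    using assms(2) unfolding shadow_isomorphic_def by blast
  let ?f = "inv_into (pverts (background S)) f" and ?g = "inv_into (pverts (overlay S)) g"
  have inj: "inj_on f (pverts (background S))"
    using fg(1) by (simp add: graph_isomorphism_def bij_betw_def)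
  have "label S (?g w) = ?f ` label T w" if w: "w \<in> pverts (overlay T)" for w
  proof -
    have g: "g ` pverts (overlay S) = pverts (overlay T)"
      using fg(2) by (simp add: graph_isomorphism_def bij_betw_def)
    then have v: "?g w \<in> pverts (overlay S)" "g (?g w) = w"
      using w by (auto intro: inv_into_into f_inv_into_f)
    then have "label S (?g w) \<subseteq> pverts (background S)"
      using assms(1) by (auto simp: is_shadow_graph_def)
    then have "?f ` f ` label S (?g w) = label S (?g w)"
      using inj by (rule inv_into_image_cancel[rotated])
    then show ?thesis
      using fg(3)[OF v(1)] v(2) by simp
  qed
  then show ?thesis
    unfolding shadow_isomorphic_def
    using graph_isomorphism_inv[OF fg(1)] graph_isomorphism_inv[OF fg(2)] by blast
qed

lemma ex_shadow_isomorphic_nat: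
  fixes S :: "('a, 'v) shadow_graph"
  assumes "is_shadow_graph S"
  obtains K :: "(nat, nat) shadow_graph" where "is_shadow_graph K" "shadow_isomorphic K S"
proof -
  obtain B :: "nat pair_pre_digraph" and f
    where B: "pair_graph B" "graph_isomorphism f B (background S)"
    using assms ex_graph_isomorphism_nat unfolding is_shadow_graph_def by blast
  obtain A :: "nat pair_pre_digraph" and g
    where A: "pair_graph A" "graph_isomorphism g A (overlay S)"
    using assms ex_graph_isomorphism_nat unfolding is_shadow_graph_def by blast
  define K where
    "K = \<lparr>background = B, overlay = A, label = (\<lambda>v. {u \<in> pverts B. f u \<in> label S (g v)})\<rparr>"
  have "is_shadow_graph K"
    using A(1) B(1) by (auto simp: K_def is_shadow_graph_def)
  moreover have "label S (g v) = f ` label K v" if "v \<in> pverts A" for v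
  proof -
    have "g v \<in> pverts (overlay S)"
      using A(2) that by (auto simp: graph_isomorphism_def dest: bij_betwE)
    then have "label S (g v) \<subseteq> f ` pverts B"
      using assms B(2) by (auto simp: is_shadow_graph_def graph_isomorphism_def bij_betw_def)
    then show ?thesis
      by (auto simp: K_def)
  qed
  then have "shadow_isomorphic K S"
    unfolding shadow_isomorphic_def using A(2) B(2)
    by (intro exI[of _ f] exI[of _ g]) (simp add: K_def)
  ultimately show ?thesis by (rule that)
qed

lemma shadow_iso_class_eq_iff:
  assumes "is_shadow_graph S" "is_shadow_graph T"
  shows "shadow_iso_class S = shadow_iso_class T \<longleftrightarrow> shadow_isomorphic S T"
proof
  assume eq: "shadow_iso_class S = shadow_iso_class T"
  obtain K :: "(nat, nat) shadow_graph" where K: "is_shadow_graph K" "shadow_isomorphic K S"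
    using ex_shadow_isomorphic_nat[OF assms(1)] .
  then have "shadow_isomorphic K T"
    using eq by (auto simp: shadow_iso_class_def)
  with K show "shadow_isomorphic S T"
    using shadow_isomorphic_sym shadow_isomorphic_trans by metis
next
  assume "shadow_isomorphic S T"
  then have "shadow_isomorphic K S \<longleftrightarrow> shadow_isomorphic K T" for K :: "(nat, nat) shadow_graph"
    using assms shadow_isomorphic_sym shadow_isomorphic_trans by metis
  then show "shadow_iso_class S = shadow_iso_class T"
    by (simp add: shadow_iso_class_def)
qed

lemma shadow_deck_isomorphic:
  fixes S :: "('a, 'v) shadow_graph" and T :: "('b, 'w) shadow_graph"
  assumes "is_shadow_graph S" "is_shadow_graph T" "shadow_isomorphic S T"
  shows "shadow_deck S = shadow_deck T"
proof -
  let ?V = "pverts (overlay S)"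
  obtain f g where fg: "graph_isomorphism f (background S) (background T)"
      "graph_isomorphism g (overlay S) (overlay T)"
      "\<And>v. v \<in> ?V \<Longrightarrow> label T (g v) = f ` label S v"
    using assms(3) unfolding shadow_isomorphic_def by blast
  then have bij: "bij_betw g ?V (pverts (overlay T))"
    by (simp add: graph_isomorphism_def)
  have "shadow_iso_class (shadow_delete_vertex T (g v)) = shadow_iso_class (shadow_delete_vertex S v)"
    if v: "v \<in> ?V" for v
  proof -
    have "pverts (delete_vertex (overlay S) v) \<subseteq> ?V"
      by (auto simp: delete_vertex_def induced_def)
    then have "shadow_isomorphic (shadow_delete_vertex S v) (shadow_delete_vertex T (g v))"
      unfolding shadow_isomorphic_def
      using fg graph_isomorphism_delete_vertex[OF fg(2) v]
      by (intro exI[of _ f] exI[of _ g]) (auto simp: shadow_delete_vertex_def)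
    then show ?thesis
      using assms(1,2) is_shadow_graph_delete_vertex shadow_iso_class_eq_iff by metis
  qed
  moreover have "finite ?V"
    using assms(1) pair_graphD(1) by (auto simp: is_shadow_graph_def)
  ultimately have "shadow_deck S =
      image_mset (\<lambda>v. shadow_iso_class (shadow_delete_vertex T (g v))) (mset_set ?V)"
    unfolding shadow_deck_def by (intro image_mset_cong) auto
  also have "\<dots> = image_mset (\<lambda>w. shadow_iso_class (shadow_delete_vertex T w))
      (image_mset g (mset_set ?V))"
    by (simp add: image_mset.compositionality o_def)
  also have "image_mset g (mset_set ?V) = mset_set (pverts (overlay T))"
    using bij by (auto simp: bij_betw_def image_mset_mset_set)
  finally show ?thesis
    by (simp add: shadow_deck_def)
qed

lemma shadow_reconstructibleD:
  fixes S :: "('a, 'v) shadow_graph" and S' :: "('b, 'w) shadow_graph"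
  assumes "shadow_reconstructible S" "is_shadow_graph S'" "shadow_deck S' = shadow_deck S"
  shows "shadow_isomorphic S' S"
proof -
  obtain K :: "(nat, nat) shadow_graph" where K: "is_shadow_graph K" "shadow_isomorphic K S'"
    using ex_shadow_isomorphic_nat[OF assms(2)] .
  then have "shadow_deck K = shadow_deck S"
    using shadow_deck_isomorphic[OF K(1) assms(2)] assms(3) by simp
  then have "shadow_isomorphic K S"
    using assms(1) K(1) unfolding shadow_reconstructible_def by blast
  with K show ?thesis
    using shadow_isomorphic_sym shadow_isomorphic_trans by metis
qed

end

theory Submission
  imports Defs
begin

text \<open>
  The vertex set \<open>A\<close> of an anchor \<open>H\<close> can be recognised from the cards of \<open>G\<close>: a vertex lies outside
  \<open>A\<close> precisely when its card still contains a copy of \<open>H\<close>, and that copy is then \<open>A\<close> itself.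
  So the cards that contain \<open>H\<close> carry the same information as the cards of the shadow graph.

  Let \<open>G'\<close> have the deck of \<open>G\<close>. Kelly's counting argument (\<open>sum_card_copies_delete_vertex\<close>)
  recovers the number of copies of \<open>H\<close> from the deck because \<open>H\<close> has fewer vertices than
  \<open>G\<close>, so \<open>G'\<close> also has exactly one copy, on a set \<open>B\<close>. Equality of the decks gives
  a bijection \<open>\<sigma>\<close> of the vertices with \<open>G' - v \<cong> G - \<sigma> v\<close>, and the remark
  above shows that \<open>\<sigma>\<close> maps the complement of \<open>B\<close> onto the complement of \<open>A\<close>. For \<open>v \<notin> B\<close> the
  isomorphism \<open>G' - v \<cong> G - \<sigma> v\<close> must take \<open>B\<close> to \<open>A\<close>, hence it induces an isomorphism of the shadow
  graphs with \<open>v\<close> and \<open>\<sigma> v\<close> deleted (\<open>shadow_isomorphic_delete_vertex\<close>). The shadow graphs of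
  \<open>G'\<close> and \<open>G\<close> therefore have the same deck and are isomorphic. Since a shadow graph records
  every edge that is not in the background, such an isomorphism glues to an isomorphism \<open>G' \<cong> G\<close>
  (\<open>isomorphic_if_shadow_isomorphic\<close>).
\<close>

text \<open>
  Lets an equality of decks be used as a matching of their cards.
\<close>
lemma ex_bij_betw_if_image_mset_eq:
  assumes "finite A" "finite B" "image_mset f (mset_set A) = image_mset g (mset_set B)"
  obtains \<sigma> where "bij_betw \<sigma> A B" "\<And>a. a \<in> A \<Longrightarrow> f a = g (\<sigma> a)"
proof -
  have "\<exists>\<sigma>. bij_betw \<sigma> A B \<and> (\<forall>a\<in>A. f a = g (\<sigma> a))"
    using assms
  proof (induction A arbitrary: B rule: finite_induct)
    case empty
    then have "B = {}"
      by (metis image_mset_is_empty_iff mset_set.empty mset_set_empty_iff)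
    then show ?case by (simp add: bij_betw_def)
  next
    case (insert x A)
    then have "f x \<in># image_mset g (mset_set B)"
      by (metis finite_insert finite_set_mset_mset_set imageI insertI1 set_image_mset)
    then obtain y where y: "y \<in> B" "f x = g y"
      using insert.prems(1) by auto
    have "mset_set B = add_mset y (mset_set (B - {y}))"
      using y(1) insert.prems(1) by (simp add: mset_set.remove)
    then have "image_mset f (mset_set A) = image_mset g (mset_set (B - {y}))"
      using insert.prems insert.hyps y(2) by simp
    then obtain \<sigma> where \<sigma>: "bij_betw \<sigma> A (B - {y})" "\<forall>a\<in>A. f a = g (\<sigma> a)"
      using insert.IH[of "B - {y}"] insert.prems(1) by auto
    let ?\<tau> = "\<sigma>(x := y)"
    have "bij_betw ?\<tau> A (B - {y})"
      using \<sigma>(1) insert.hyps(2) by (subst bij_betw_cong[of A _ \<sigma>]) auto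
    then have "bij_betw ?\<tau> (insert x A) (insert y (B - {y}))"
      using insert.hyps(2) by (auto simp: bij_betw_def)
    moreover have "insert y (B - {y}) = B"
      using y(1) by blast
    moreover have "\<forall>a\<in>insert x A. f a = g (?\<tau> a)"
      using \<sigma>(2) y(2) insert.hyps(2) by auto
    ultimately show ?case
      by metis
  qed
  then show ?thesis
    using that by blast
qed

section \<open>Copies of a graph\<close>

definition copies :: "'b pair_pre_digraph \<Rightarrow> 'a pair_pre_digraph \<Rightarrow> 'a set set" where
  "copies H G = {W. W \<subseteq> pverts G \<and> isomorphic (induced G W) H}"

lemma anchor_copies:
  assumes "anchor H G"
  shows "copies H G = {pverts H}" "pverts H \<subseteq> pverts G" "induced G (pverts H) = H"
proof -
  have sub: "induced_subgraph (with_proj H) (with_proj G)"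
    using assms by (simp add: anchor_def)
  show H: "induced G (pverts H) = H"
    using induced_subgraph_eq_induced[OF sub] by simp
  show "pverts H \<subseteq> pverts G"
    using sub by (auto simp: induced_subgraph_def subgraph_def)
  then show "copies H G = {pverts H}"
    using assms isomorphic_refl[of H] H by (auto simp: copies_def anchor_def)
qed

lemma finite_copies: "pair_graph G \<Longrightarrow> finite (copies H G)"
  using pair_graphD(1)[of G] by (auto simp: copies_def intro: finite_subset[of _ "Pow (pverts G)"])

lemma card_copy: "W \<in> copies H G \<Longrightarrow> card W = card (pverts H)"
  by (auto simp: copies_def isomorphic_def graph_isomorphism_def induced_def bij_betw_same_card)

lemma graph_isomorphism_induced:
  assumes "graph_isomorphism f G K" "W \<subseteq> pverts G"
  shows "graph_isomorphism f (induced G W) (induced K (f ` W))"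
  using assms by (auto simp: graph_isomorphism_def induced_def bij_betw_def
      intro: inj_on_subset)

lemma image_in_copies:
  assumes f: "graph_isomorphism f G K" and W: "W \<in> copies H G"
  shows "f ` W \<in> copies H K"
proof -
  have "isomorphic (induced G W) (induced K (f ` W))"
    using graph_isomorphism_induced[OF f] W by (auto simp: copies_def isomorphic_def)
  moreover have "f ` W \<subseteq> pverts K"
    using f W by (auto simp: copies_def graph_isomorphism_def bij_betw_def)
  ultimately show ?thesis
    using W isomorphic_sym isomorphic_trans unfolding copies_def by blast
qed

lemma card_copies_le:
  assumes f: "graph_isomorphism f G K" and "pair_graph K"
  shows "card (copies H G) \<le> card (copies H K)"
proof (rule card_inj_on_le[where f = "image f"])
  have "inj_on f (pverts G)"
    using f by (simp add: graph_isomorphism_def bij_betw_def)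
  then show "inj_on (image f) (copies H G)"
    by (intro inj_on_subset[OF inj_on_image_Pow]) (auto simp: copies_def)
qed (use assms image_in_copies finite_copies in auto)

lemma card_copies_isomorphic:
  assumes "pair_graph G" "pair_graph K" "isomorphic G K"
  shows "card (copies H G) = card (copies H K)"
  using assms card_copies_le isomorphic_sym unfolding isomorphic_def by (metis le_antisym)

lemma induced_delete_vertex:
  assumes "W \<subseteq> pverts G" "v \<notin> W"
  shows "induced (delete_vertex G v) W = induced G W"
  using assms by (auto simp: delete_vertex_def induced_def)

lemma copies_delete_vertex: "copies H (delete_vertex G v) = {W \<in> copies H G. v \<notin> W}"
proof -
  have "W \<subseteq> pverts (delete_vertex G v) \<longleftrightarrow> W \<subseteq> pverts G \<and> v \<notin> W" for W
    by (auto simp: delete_vertex_def induced_def)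
  then show ?thesis
    by (auto simp: copies_def induced_delete_vertex)
qed

lemma pair_graph_delete_vertex: "pair_graph G \<Longrightarrow> pair_graph (delete_vertex G v)"
  by (auto simp: delete_vertex_def intro: pair_graph_induced)

text \<open>
  Kelly's lemma. Both sides count the pairs of a copy and a vertex outside it: a copy survives in
  exactly those cards whose missing vertex it avoids.
\<close>
lemma sum_card_copies_delete_vertex:
  assumes G: "pair_graph G"
  shows "(\<Sum>v\<in>pverts G. card (copies H (delete_vertex G v))) =
    (card (pverts G) - card (pverts H)) * card (copies H G)"
proof -
  note fin = pair_graphD(1)[OF G]
  have "(\<Sum>v\<in>pverts G. card (copies H (delete_vertex G v))) =
      (\<Sum>v\<in>pverts G. card {W \<in> copies H G. v \<notin> W})"
    by (simp add: copies_delete_vertex)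
  also have "\<dots> = (\<Sum>W\<in>copies H G. card {v \<in> pverts G. v \<notin> W})"
    using finite_copies[OF G, of H] fin by (intro sum_multicount_gen) auto
  also have "\<dots> = (\<Sum>W\<in>copies H G. card (pverts G) - card (pverts H))"
  proof (rule sum.cong[OF refl])
    fix W assume W: "W \<in> copies H G"
    then have "W \<subseteq> pverts G"
      by (simp add: copies_def)
    moreover have "{v \<in> pverts G. v \<notin> W} = pverts G - W"
      by blast
    ultimately show "card {v \<in> pverts G. v \<notin> W} = card (pverts G) - card (pverts H)"
      using card_copy[OF W] fin by (metis card_Diff_subset finite_subset)
  qed
  finally show ?thesis
    by simp
qed

section \<open>Shadow graphs of isomorphic graphs\<close>

lemma shadow_isomorphic_shadow_of:
  assumes f: "graph_isomorphism f G K" and A: "A \<subseteq> pverts G"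
  shows "shadow_isomorphic (shadow_of G (induced G A)) (shadow_of K (induced K (f ` A)))"
proof -
  have inj: "inj_on f (pverts G)" and im: "f ` pverts G = pverts K"
    using f by (auto simp: graph_isomorphism_def bij_betw_def)
  have "f ` (pverts G - A) = pverts K - f ` A"
    using inj_on_image_set_diff[OF inj, of "pverts G" A] A im by auto
  then have "graph_isomorphism f (induced G (pverts G - A)) (induced K (pverts K - f ` A))"
    using graph_isomorphism_induced[OF f, of "pverts G - A"] by auto
  moreover have "{w \<in> f ` A. (f v, w) \<in> parcs K} = f ` {w \<in> A. (v, w) \<in> parcs G}"
    if "v \<in> pverts G" for v
    using f that A by (auto simp: graph_isomorphism_def)
  ultimately show ?thesis
    using graph_isomorphism_induced[OF f A]
    unfolding shadow_isomorphic_def shadow_of_def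
    by (intro exI[of _ f]) (auto simp: induced_def)
qed

text \<open>
  These are isomorphic rather than equal, because the two label functions can differ at \<open>v\<close>:
  on the left \<open>v\<close> has already lost its neighbours.
\<close>
lemma shadow_of_delete_vertex:
  assumes "pverts H \<subseteq> pverts G" "v \<notin> pverts H"
  shows "shadow_isomorphic (shadow_of (delete_vertex G v) H) (shadow_delete_vertex (shadow_of G H) v)"
  unfolding shadow_isomorphic_def
proof (intro exI[of _ id] conjI)
  have "overlay (shadow_of (delete_vertex G v) H) = overlay (shadow_delete_vertex (shadow_of G H) v)"
    by (auto simp: shadow_of_def shadow_delete_vertex_def delete_vertex_def induced_def)
  then show "graph_isomorphism id (overlay (shadow_of (delete_vertex G v) H))
      (overlay (shadow_delete_vertex (shadow_of G H) v))"
    by (simp add: graph_isomorphism_id)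
qed (use assms in \<open>auto simp: shadow_of_def shadow_delete_vertex_def delete_vertex_def induced_def
      graph_isomorphism_def\<close>)

lemma is_shadow_graph_shadow_of_induced:
  assumes "pair_graph G" "A \<subseteq> pverts G"
  shows "is_shadow_graph (shadow_of G (induced G A))"
  using assms pair_graph_induced[OF assms] pair_graph_induced[of G "pverts G - A"]
  by (auto simp: is_shadow_graph_def shadow_of_def induced_def)

text \<open>
  Uniqueness of the copy is what makes every isomorphism of the cards respect the backgrounds, so
  that it is an isomorphism of shadow graphs.
\<close>
lemma shadow_isomorphic_delete_vertex:
  assumes G: "pair_graph G" "copies H G = {A}" "v \<notin> A"
    and K: "pair_graph K" "copies H K = {B}" "w \<notin> B"
    and iso: "isomorphic (delete_vertex G v) (delete_vertex K w)"
  shows "shadow_isomorphic (shadow_delete_vertex (shadow_of G (induced G A)) v)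
    (shadow_delete_vertex (shadow_of K (induced K B)) w)"
proof -
  obtain f where f: "graph_isomorphism f (delete_vertex G v) (delete_vertex K w)"
    using iso isomorphic_def by blast
  have "A \<in> copies H G" "B \<in> copies H K"
    using G(2) K(2) by simp_all
  then have A: "A \<subseteq> pverts G" and B: "B \<subseteq> pverts K"
    by (simp_all add: copies_def)
  have "A \<in> copies H (delete_vertex G v)"
    using G(2,3) by (simp add: copies_delete_vertex)
  then have "f ` A = B"
    using image_in_copies[OF f, of A H] K(2) by (simp add: copies_delete_vertex)
  moreover have A': "A \<subseteq> pverts (delete_vertex G v)"
    using A G(3) by (auto simp: delete_vertex_def induced_def)
  ultimately have GK: "shadow_isomorphic (shadow_of (delete_vertex G v) (induced G A))
      (shadow_of (delete_vertex K w) (induced K B))"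
    using shadow_isomorphic_shadow_of[OF f, of A] induced_delete_vertex[OF A G(3)]
      induced_delete_vertex[OF B K(3)] by simp
  have del_G: "shadow_isomorphic (shadow_delete_vertex (shadow_of G (induced G A)) v)
      (shadow_of (delete_vertex G v) (induced G A))"
  proof (rule shadow_isomorphic_sym)
    show "is_shadow_graph (shadow_of (delete_vertex G v) (induced G A))"
      using is_shadow_graph_shadow_of_induced[OF pair_graph_delete_vertex[OF G(1)] A']
        induced_delete_vertex[OF A G(3)] by simp
    show "shadow_isomorphic (shadow_of (delete_vertex G v) (induced G A))
        (shadow_delete_vertex (shadow_of G (induced G A)) v)"
      using A G(3) by (intro shadow_of_delete_vertex) (auto simp: induced_def)
  qed
  have del_K: "shadow_isomorphic (shadow_of (delete_vertex K w) (induced K B))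
      (shadow_delete_vertex (shadow_of K (induced K B)) w)"
    using B K(3) by (intro shadow_of_delete_vertex) (auto simp: induced_def)
  show ?thesis
    by (rule shadow_isomorphic_trans[OF shadow_isomorphic_trans[OF del_G GK] del_K])
qed

text \<open>
  The isomorphism is glued from the map of the backgrounds and the map of the overlays; the labels
  take care of the edges between the two parts.
\<close>
lemma isomorphic_if_shadow_isomorphic:
  assumes G: "pair_graph G" "A \<subseteq> pverts G" and K: "pair_graph K" "B \<subseteq> pverts K"
    and iso: "shadow_isomorphic (shadow_of G (induced G A)) (shadow_of K (induced K B))"
  shows "isomorphic G K"
proof -
  obtain f g where f: "graph_isomorphism f (induced G A) (induced K B)"
    and g: "graph_isomorphism g (induced G (pverts G - A)) (induced K (pverts K - B))"
    and lab: "\<And>u. u \<in> pverts G - A \<Longrightarrow>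
      {w \<in> B. (g u, w) \<in> parcs K} = f ` {w \<in> A. (u, w) \<in> parcs G}"
    using iso unfolding shadow_isomorphic_def shadow_of_def by (auto simp: induced_def)
  define h where "h x = (if x \<in> A then f x else g x)" for x
  have bf: "bij_betw f A B" and bg: "bij_betw g (pverts G - A) (pverts K - B)"
    using f g by (auto simp: graph_isomorphism_def induced_def)
  have "bij_betw h A B"
    using bf by (subst bij_betw_cong[of A h f]) (auto simp: h_def)
  moreover have "bij_betw h (pverts G - A) (pverts K - B)"
    using bg by (subst bij_betw_cong[of _ h g]) (auto simp: h_def)
  ultimately have "bij_betw h (A \<union> (pverts G - A)) (B \<union> (pverts K - B))"
    by (rule bij_betw_combine) auto
  moreover have "A \<union> (pverts G - A) = pverts G" "B \<union> (pverts K - B) = pverts K"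
    using G(2) K(2) by auto
  ultimately have bij: "bij_betw h (pverts G) (pverts K)"
    by simp
  have cross: "(u, v) \<in> parcs G \<longleftrightarrow> (g u, f v) \<in> parcs K" if "u \<in> pverts G - A" "v \<in> A" for u v
  proof -
    have "f v \<in> B"
      using bf that(2) by (auto simp: bij_betw_def)
    then have "(g u, f v) \<in> parcs K \<longleftrightarrow> f v \<in> f ` {w \<in> A. (u, w) \<in> parcs G}"
      using lab[OF that(1)] by blast
    also have "\<dots> \<longleftrightarrow> (u, v) \<in> parcs G"
      using bf that(2) by (auto simp: bij_betw_def dest: inj_onD)
    finally show ?thesis ..
  qed
  have swap: "(x, y) \<in> parcs G \<longleftrightarrow> (y, x) \<in> parcs G" "(p, q) \<in> parcs K \<longleftrightarrow> (q, p) \<in> parcs K"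
    for x y p q
    using pair_graphD(3)[OF G(1)] pair_graphD(3)[OF K(1)] by (auto dest: symD)
  have "(u, v) \<in> parcs G \<longleftrightarrow> (h u, h v) \<in> parcs K" if uv: "u \<in> pverts G" "v \<in> pverts G" for u v
  proof -
    consider "u \<in> A" "v \<in> A" | "u \<notin> A" "v \<in> A" | "u \<in> A" "v \<notin> A" | "u \<notin> A" "v \<notin> A"
      by blast
    then show ?thesis
    proof cases
      case 1
      then show ?thesis
        using f bij_betwE[OF bf] by (auto simp: graph_isomorphism_def induced_def h_def)
    next
      case 2
      then show ?thesis
        using cross uv by (simp add: h_def)
    next
      case 3
      then show ?thesis
        using cross[of v u] uv swap(1)[of u v] swap(2)[of "f u" "g v"] by (simp add: h_def)
    next
      case 4
      then show ?thesis
        using g bij_betwE[OF bg] uv by (auto simp: graph_isomorphism_def induced_def h_def)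
    qed
  qed
  with bij have "graph_isomorphism h G K"
    by (simp add: graph_isomorphism_def)
  then show ?thesis
    by (auto simp: isomorphic_def)
qed

section \<open>Reconstruction from an anchor\<close>

lemma deck_eqE:
  assumes "pair_graph G" "pair_graph K" "deck G = deck K"
  obtains \<sigma> where "bij_betw \<sigma> (pverts G) (pverts K)"
    "\<And>v. v \<in> pverts G \<Longrightarrow> isomorphic (delete_vertex G v) (delete_vertex K (\<sigma> v))"
proof -
  obtain \<sigma> where \<sigma>: "bij_betw \<sigma> (pverts G) (pverts K)"
    and cards: "\<And>v. v \<in> pverts G \<Longrightarrow>
      iso_class (delete_vertex G v) = iso_class (delete_vertex K (\<sigma> v))"
    using ex_bij_betw_if_image_mset_eq[OF pair_graphD(1)[OF assms(1)] pair_graphD(1)[OF assms(2)]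
        assms(3)[unfolded deck_def]] by blast
  have "isomorphic (delete_vertex G v) (delete_vertex K (\<sigma> v))" if "v \<in> pverts G" for v
    using cards[OF that] iso_class_eq_iff pair_graph_delete_vertex[OF assms(1)]
      pair_graph_delete_vertex[OF assms(2)] by blast
  with \<sigma> show ?thesis
    by (rule that)
qed

theorem proposition1:
  fixes G H :: "'a pair_pre_digraph" and n :: nat
  assumes "pair_graph G"
    and "card (pverts G) = n"
    and "anchor H G"
    and "card (pverts H) + 3 \<le> n"
    and "shadow_reconstructible (shadow_of G H)"
  shows "reconstructible G"
  unfolding reconstructible_def
proof (intro allI impI, elim conjE)
  fix G' :: "nat pair_pre_digraph"
  assume G': "pair_graph G'" and deck: "deck G' = deck G"
  note G = assms(1)
  define A where "A = pverts H"
  note H = anchor_copies[OF assms(3), folded A_def]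
  obtain \<sigma> where \<sigma>: "bij_betw \<sigma> (pverts G') (pverts G)"
    and iso: "\<And>v. v \<in> pverts G' \<Longrightarrow> isomorphic (delete_vertex G' v) (delete_vertex G (\<sigma> v))"
    using deck_eqE[OF G' G deck] by blast
  have card_eq: "card (copies H (delete_vertex G' v)) = card (copies H (delete_vertex G (\<sigma> v)))"
    if "v \<in> pverts G'" for v
    using that iso card_copies_isomorphic pair_graph_delete_vertex G G' by metis
  have "(n - card A) * card (copies H G') = (\<Sum>v\<in>pverts G'. card (copies H (delete_vertex G' v)))"
    using sum_card_copies_delete_vertex[OF G', of H] bij_betw_same_card[OF \<sigma>] assms(2)
    by (simp add: A_def)
  also have "\<dots> = (\<Sum>v\<in>pverts G. card (copies H (delete_vertex G v)))"
    using card_eq sum.reindex_bij_betw[OF \<sigma>, of "\<lambda>v. card (copies H (delete_vertex G v))"] by simp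
  also have "\<dots> = n - card A"
    using sum_card_copies_delete_vertex[OF G, of H] assms(2) H(1) by (simp add: A_def)
  \<comment> \<open>The factor \<open>n - card A\<close> is positive, so it cancels.\<close>
  finally have "card (copies H G') = 1"
    using assms(4) by (simp add: A_def)
  then obtain B where B: "copies H G' = {B}"
    by (meson card_1_singletonE)
  then have "B \<in> copies H G'"
    by simp
  then have B_sub: "B \<subseteq> pverts G'"
    by (simp add: copies_def)
  \<comment> \<open>Both sides say that the card has lost the copy: it counts \<open>0\<close> copies instead of \<open>1\<close>.\<close>
  have mem: "v \<in> B \<longleftrightarrow> \<sigma> v \<in> A" if "v \<in> pverts G'" for v
    using card_eq[OF that] B H(1) by (auto simp: copies_delete_vertex Collect_conv_if split: if_splits)
  have \<sigma>': "bij_betw \<sigma> (pverts G' - B) (pverts G - A)"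
  proof -
    have "\<sigma> ` (pverts G' - B) = pverts G - A"
      using \<sigma> mem by (force simp: bij_betw_def)
    then show ?thesis
      using \<sigma> by (auto simp: bij_betw_def intro: inj_on_subset)
  qed

  let ?S = "shadow_of G H" and ?S' = "shadow_of G' (induced G' B)"
  have S: "is_shadow_graph ?S" and S': "is_shadow_graph ?S'"
    using is_shadow_graph_shadow_of_induced[OF G H(2)] H(3)
      is_shadow_graph_shadow_of_induced[OF G' B_sub] by auto
  have "shadow_iso_class (shadow_delete_vertex ?S' v) =
      shadow_iso_class (shadow_delete_vertex ?S (\<sigma> v))" if v: "v \<in> pverts G' - B" for v
  proof -
    have "shadow_isomorphic (shadow_delete_vertex ?S' v) (shadow_delete_vertex ?S (\<sigma> v))"
      using shadow_isomorphic_delete_vertex[OF G' B _ G H(1) _ iso] v mem H(3) by auto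
    then show ?thesis
      using shadow_iso_class_eq_iff is_shadow_graph_delete_vertex S S' by metis
  qed
  then have "image_mset (\<lambda>v. shadow_iso_class (shadow_delete_vertex ?S' v))
        (mset_set (pverts G' - B)) =
      image_mset (\<lambda>v. shadow_iso_class (shadow_delete_vertex ?S (\<sigma> v))) (mset_set (pverts G' - B))"
    using pair_graphD(1)[OF G'] by (intro image_mset_cong) auto
  also have "\<dots> = image_mset (\<lambda>v. shadow_iso_class (shadow_delete_vertex ?S v))
      (image_mset \<sigma> (mset_set (pverts G' - B)))"
    by (simp add: image_mset.compositionality o_def)
  also have "image_mset \<sigma> (mset_set (pverts G' - B)) = mset_set (pverts G - A)"
    using \<sigma>' by (auto simp: bij_betw_def image_mset_mset_set)
  finally have "shadow_deck ?S' = shadow_deck ?S"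
    by (simp add: shadow_deck_def shadow_of_def induced_def A_def)
  then have "shadow_isomorphic ?S' ?S"
    using shadow_reconstructibleD[OF assms(5) S'] by simp
  then show "isomorphic G' G"
    using isomorphic_if_shadow_isomorphic[OF G' B_sub G H(2)] H(3) by simp
qed

end
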